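(* Let $T_0$ be a tree of order $n\geq 7$ containing a proper pendant path $P=v_{k+1}v_k\cdots v_2v_1$ of length $k$, where $v_{k+1}$ is its root (and $v_1$ is its pendant end). Let $T_0^*$ be the subtree of $T_0$ obtained by removing all the vertices of $P$ but $v_{k+1}$, and let $T_0'$ be a copy of $T_0$ (vertex-disjoint from $T_0$) with the vertex $v_1'\in V(T_0')$ corresponding to $v_1$. Let $T$ be the tree obtained from $T_0$ and $T_0'$ by joining the vertices $v_1$ and $v_1'$ by an edge, and by attaching a new leaf $w$ at $v_1$. If $T_0^*$ is a partially transmission irregular subgraph of $T_0$ and a DBTM subtree of $T_0$ at $v_{k+1}$, and if $j^2+1<2n<(j+1)^2$ for some $j\in\{1,\ldots,k\}$, then $T$ is transmission irregular.
   Context: All graphs are finite, simple and connected. The order $n(G)$ is the number of vertices of $G$. For a vertex $x$ of $G$, $\mathrm{Tr}_G(x)=\sum_{u\in V(G)\setminus\{x\}}d_G(x,u)$ is its transmission, where $d_G$ is the shortest-path distance. $G$ is transmission irregular if any two distinct vertices have different transmissions. An induced subgraph $H$ of $G$ is partially transmission irregular if $|\{\mathrm{Tr}_G(u):u\in V(H)\}|=n(H)$ (transmissions are computed in $G$). A path $u_{k}u_{k-1}\cdots u_2u_1$ in a graph $G$ is a proper pendant path with root $u_k$ if $\deg_G(u_k)\ge 3$, $\deg_G(u_1)=1$ and $\deg_G(u_i)=2$ for $i\in\{2,\ldots,k-1\}$. The length of a path is its number of edges. Let $S$ be a tree, $S_0$ a subtree of $S$, and $v$ a non-leaf vertex of $S_0$.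 Let $V_j$ be the set of vertices at distance $j$ from $v$ in $S_0$, and let $a$ be the eccentricity of $v$ in $S_0$ (the maximum distance from $v$ to a vertex of $S_0$). Then $S_0$ is a distance-based transmission monotonic (DBTM) subtree of $S$ at $v$ if $\min_{u\in V_{j+1}}\mathrm{Tr}_S(u)\geq \max_{u\in V_j}\mathrm{Tr}_S(u)$ for every $j\in\{1,\ldots,a-1\}$. *)

theory Defs
  imports "Graph_Theory.Graph_Theory"
begin

text \<open>
  Finite simple graphs are the symmetric digraphs of the locale \<^locale>\<open>graph\<close> (finite,
  loop-free, without parallel arcs): an edge is a pair of opposite arcs. The degree of a vertex
  is therefore its out-degree.

  The library's own predicate \<open>tree\<close> is not suitable for such graphs, because it counts an edge
  traversed back and forth as a cycle. A cycle of the undirected graph is a library cycle of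
  length at least 3.
\<close>

definition graph_tree :: "('a, 'b) pre_digraph \<Rightarrow> bool" where
  "graph_tree G \<longleftrightarrow> graph G \<and> Digraph_Component.connected G \<and>
     (\<nexists>p. pre_digraph.cycle G p \<and> length p \<ge> 3)"

text \<open>Only meaningful if some path joins the two vertices, as in any connected graph.\<close>

definition gdist :: "('a, 'b) pre_digraph \<Rightarrow> 'a \<Rightarrow> 'a \<Rightarrow> nat" where
  "gdist G u v = (LEAST l. \<exists>p. pre_digraph.apath G u p v \<and> length p = l)"

text \<open>This is the library's shortest-path distance for unit arc weights.\<close>

lemma (in graph) ereal_gdist:
  assumes "u \<rightarrow>\<^sup>*\<^bsub>G\<^esub> v"
  shows "ereal (real (gdist G u v)) = \<mu> (\<lambda>_. 1) u v"
proof -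
  have cost: "awalk_cost (\<lambda>_. 1) p = real (length p)" for p
    by (induction p) simp_all
  obtain p where p: "apath u p v" and mu: "\<mu> (\<lambda>_. 1) u v = ereal (real (length p))"
    using min_cost_awalk[OF assms, of "\<lambda>_. 1"] by (auto simp: cost)
  have "length p \<le> l" if l: "\<exists>q. apath u q v \<and> length q = l" for l
  proof -
    obtain q where q: "apath u q v" "length q = l"
      using l by auto
    have "\<mu> (\<lambda>_. 1) u v \<le> ereal (awalk_cost (\<lambda>_. 1) q)"
      using q(1) by (intro min_cost_le_walk_cost) (simp add: apath_def)
    then show ?thesis
      by (simp add: mu cost q(2))
  qed
  then have "gdist G u v = length p"
    unfolding gdist_def by (intro Least_equality exI[of _ p] conjI p refl)
  then show ?thesis
    by (simp add: mu)
qed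

definition transmission :: "('a, 'b) pre_digraph \<Rightarrow> 'a \<Rightarrow> nat" where
  "transmission G x = (\<Sum>u \<in> verts G - {x}. gdist G x u)"

definition transmission_irregular :: "('a, 'b) pre_digraph \<Rightarrow> bool" where
  "transmission_irregular G \<longleftrightarrow>
     (\<forall>x \<in> verts G. \<forall>y \<in> verts G. x \<noteq> y \<longrightarrow> transmission G x \<noteq> transmission G y)"

definition partially_transmission_irregular ::
  "('a, 'b) pre_digraph \<Rightarrow> ('a, 'b) pre_digraph \<Rightarrow> bool" where
  "partially_transmission_irregular H G \<longleftrightarrow>
     induced_subgraph H G \<and> card (transmission G ` verts H) = card (verts H)"

text \<open>The list contains the vertices of the path, from the root to the pendant end.\<close>

definition proper_pendant_path :: "('a, 'b) pre_digraph \<Rightarrow> 'a vwalk \<Rightarrow> bool" where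
  "proper_pendant_path G us \<longleftrightarrow> vpath us G \<and>
     out_degree G (hd us) \<ge> 3 \<and> out_degree G (last us) = 1 \<and>
     (\<forall>u \<in> set (butlast (tl us)). out_degree G u = 2)"

definition eccentricity :: "('a, 'b) pre_digraph \<Rightarrow> 'a \<Rightarrow> nat" where
  "eccentricity G v = Max (gdist G v ` verts G)"

definition dist_level :: "('a, 'b) pre_digraph \<Rightarrow> 'a \<Rightarrow> nat \<Rightarrow> 'a set" where
  "dist_level G v j = {u \<in> verts G. gdist G v u = j}"

text \<open>Levels are taken in the subtree \<open>S\<^sub>0\<close>, transmissions in the whole tree \<open>S\<close>.\<close>

definition DBTM_subtree ::
  "('a, 'b) pre_digraph \<Rightarrow> ('a, 'b) pre_digraph \<Rightarrow> 'a \<Rightarrow> bool" where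
  "DBTM_subtree S\<^sub>0 S v \<longleftrightarrow>
     graph_tree S \<and> graph_tree S\<^sub>0 \<and> subgraph S\<^sub>0 S \<and>
     v \<in> verts S\<^sub>0 \<and> out_degree S\<^sub>0 v \<noteq> 1 \<and>
     (\<forall>j \<in> {1..eccentricity S\<^sub>0 v - 1}.
        Min (transmission S ` dist_level S\<^sub>0 v (j + 1))
          \<ge> Max (transmission S ` dist_level S\<^sub>0 v j))"

definition is_copy :: "('a \<Rightarrow> 'a) \<Rightarrow> 'a pair_pre_digraph \<Rightarrow> 'a pair_pre_digraph \<Rightarrow> bool" where
  "is_copy \<phi> G G' \<longleftrightarrow>
     bij_betw \<phi> (pverts G) (pverts G') \<and> parcs G' = map_prod \<phi> \<phi> ` parcs G"

definition join_with_leaf ::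
  "'a pair_pre_digraph \<Rightarrow> 'a \<Rightarrow> 'a pair_pre_digraph \<Rightarrow> 'a \<Rightarrow> 'a \<Rightarrow> 'a pair_pre_digraph" where
  "join_with_leaf G x G' x' w = \<lparr>
     pverts = pverts G \<union> pverts G' \<union> {w},
     parcs = parcs G \<union> parcs G' \<union> {(x, x'), (x', x)} \<union> {(x, w), (w, x)} \<rparr>"

end

theory Submission
  imports Defs
begin

text \<open>
  Let \<open>d\<close> be the distance in \<open>T\<^sub>0\<close> and \<open>D\<close> the transmission of the pendant end \<open>v\<^sub>1\<close> in \<open>T\<^sub>0\<close>. The new
  edges of \<open>T\<close> are bridges, so the transmission in \<open>T\<close> of a vertex \<open>x\<close> of \<open>T\<^sub>0\<close> is
  \<open>F x = Tr x + (n + 1) * (d x v\<^sub>1 + 1) + D\<close>, where \<open>Tr\<close> is the transmission in \<open>T\<^sub>0\<close>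
  (below, \<open>F\<close> is called \<open>joined_transmission\<close>). Its image in the copy has transmission \<open>F x + 1\<close>, and the leaf \<open>w\<close> has transmission \<open>2 * D + 3 * n\<close>
  (lemmas \<open>transmission_T\<close> and \<open>transmission_T_leaf\<close>). It is therefore enough that the values of \<open>F\<close> on
  distinct vertices differ by at least 2, and that neither \<open>F x\<close> nor \<open>F x + 1\<close> is \<open>2 * D + 3 * n\<close>.

  On the pendant path, the vertex \<open>v\<^sub>i\<close> has \<open>F v\<^sub>i = 2 * D + n + i\<^sup>2\<close> (lemma
  \<open>joined_transmission_P\<close>). Hence consecutive values differ by at least 3, and the condition on the
  squares around \<open>2 * n\<close> says that the value of the leaf falls strictly between two of them, with no
  path value just below it.

  In the rest of \<open>T\<^sub>0\<close> the triangle inequality shows that \<open>F\<close> exceeds its value at the root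
  by at least 3 times the distance from the root (lemma \<open>joined_transmission_outer_ge\<close>), so these
  vertices collide neither with the path nor with the leaf. Two of them at different positive distances
  from the root are kept apart by the monotonicity hypothesis, since the distance term of \<open>F\<close> alone
  differs by \<open>n + 1\<close> or more. Two of them at equal distance have different transmissions in \<open>T\<^sub>0\<close>
  by hypothesis, and a tree being bipartite, these have the same parity, so they differ by at
  least 2 (lemma \<open>transmission_parity\<close>).
\<close>

section \<open>Distance in connected graphs\<close>

locale connected_graph = graph +
  assumes connected: "Digraph_Component.connected G"
begin

lemma reachable: "u \<in> verts G \<Longrightarrow> v \<in> verts G \<Longrightarrow> u \<rightarrow>\<^sup>* v"
  using symmetric_connected_imp_strongly_connected[OF sym_arcs connected] by blast

lemma gdist_apath:
  assumes "u \<in> verts G" "v \<in> verts G"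
  obtains p where "apath u p v" "length p = gdist G u v"
proof -
  have "\<exists>l p. apath u p v \<and> length p = l"
    using reachable[OF assms] by (auto simp: reachable_apath)
  from LeastI_ex[OF this] show ?thesis
    using that unfolding gdist_def by blast
qed

lemma gdist_le_awalk:
  assumes "awalk u p v"
  shows "gdist G u v \<le> length p"
proof -
  have cost: "awalk_cost (\<lambda>_. 1) p = real (length p)" for p
    by (induction p) simp_all
  have "u \<rightarrow>\<^sup>* v"
    using assms by (rule reachable_awalkI)
  from ereal_gdist[OF this] min_cost_le_walk_cost[OF assms, of "\<lambda>_. 1"]
  have "ereal (real (gdist G u v)) \<le> ereal (real (length p))"
    by (simp only: cost)
  then show ?thesis by simp
qed

lemma gdist_self [simp]: "u \<in> verts G \<Longrightarrow> gdist G u u = 0"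
  using gdist_le_awalk[of u "[]" u] by (simp add: awalk_Nil_iff)

lemma gdist_0: "u \<in> verts G \<Longrightarrow> v \<in> verts G \<Longrightarrow> gdist G u v = 0 \<Longrightarrow> u = v"
  by (metis gdist_apath awalk_empty_ends awalkI_apath length_0_conv)

lemma gdist_triangle:
  assumes "u \<in> verts G" "v \<in> verts G" "x \<in> verts G"
  shows "gdist G u v \<le> gdist G u x + gdist G x v"
proof -
  obtain p q where "apath u p x" "length p = gdist G u x"
    and "apath x q v" "length q = gdist G x v"
    using assms by (meson gdist_apath)
  then show ?thesis
    using gdist_le_awalk[of u "p @ q" v] by (auto simp: apath_def)
qed

lemma gdist_adj:
  assumes "x \<rightarrow>\<^bsub>G\<^esub> y"
  shows "gdist G x y \<le> 1"
proof -
  obtain e where "e \<in> arcs G" "tail G e = x" "head G e = y"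
    using assms by (auto simp: arcs_ends_conv)
  then have "awalk x [e] y"
    by (auto simp: awalk_simps)
  from gdist_le_awalk[OF this] show ?thesis by simp
qed

lemma gdist_lipschitz:
  assumes "u \<in> verts G" "x \<rightarrow>\<^bsub>G\<^esub> y"
  shows "gdist G u y \<le> gdist G u x + 1"
  using gdist_triangle[of u y x] gdist_adj[OF assms(2)] assms(1) adj_in_verts[OF assms(2)]
  by simp

lemma gdist_predecessor:
  assumes "u \<in> verts G" "v \<in> verts G" "gdist G u v = Suc m"
  obtains x where "x \<rightarrow>\<^bsub>G\<^esub> v" "gdist G u x = m"
proof -
  obtain p where p: "apath u p v" "length p = Suc m"
    using gdist_apath[OF assms(1,2)] assms(3) by metis
  then obtain q e where q: "p = q @ [e]"
    by (metis length_Suc_conv_rev)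
  then have w: "awalk u q (tail G e)" "tail G e \<rightarrow>\<^bsub>G\<^esub> v" and len: "length q = m"
    using p by (auto simp: apath_def awalk_simps arcs_ends_conv)
  have "gdist G u (tail G e) = m"
    using gdist_le_awalk[OF w(1)] gdist_lipschitz[OF assms(1) w(2)] assms(3) len by simp
  with w(2) show ?thesis by (rule that)
qed

lemma gdist_induct [consumes 2, case_names root step]:
  assumes "u \<in> verts G" "v \<in> verts G"
    and "P u"
    and "\<And>x y. x \<rightarrow>\<^bsub>G\<^esub> y \<Longrightarrow> gdist G u y = Suc (gdist G u x) \<Longrightarrow> P x \<Longrightarrow> P y"
  shows "P v"
  using assms(2)
proof (induction "gdist G u v" arbitrary: v)
  case 0
  then show ?case using gdist_0[OF assms(1)] assms(3) by auto
next
  case (Suc m)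
  obtain x where x: "x \<rightarrow>\<^bsub>G\<^esub> v" "gdist G u x = m"
    using gdist_predecessor[OF assms(1) Suc.prems] Suc.hyps(2) by metis
  then have "P x"
    using Suc.hyps(1) adj_in_verts(1) by blast
  with x assms(4) Suc.hyps(2) show ?case by metis
qed

text \<open>
  Distance from \<open>u\<close> is the largest function that vanishes at \<open>u\<close> and grows by at most 1 along each
  arc. All lower bounds on distances below come from this: a candidate formula that changes by at
  most 1 along arcs is a lower bound, and no path has to be cut or rerouted.
\<close>

lemma lipschitz_le_gdist:
  fixes h :: "'a \<Rightarrow> int"
  assumes "u \<in> verts G" "v \<in> verts G"
    and "\<And>x y. x \<rightarrow>\<^bsub>G\<^esub> y \<Longrightarrow> h y \<le> h x + 1"
  shows "h v \<le> h u + int (gdist G u v)"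
  using assms(1,2)
proof (induction rule: gdist_induct)
  case root
  then show ?case using assms(1) by simp
next
  case (step x y)
  then show ?case using assms(3)[OF step(1)] by simp
qed

lemma adj_sym: "x \<rightarrow>\<^bsub>G\<^esub> y \<Longrightarrow> y \<rightarrow>\<^bsub>G\<^esub> x"
  using sym_arcs by (rule arcs_ends_symmetric)

lemma gdist_sym:
  assumes "u \<in> verts G" "v \<in> verts G"
  shows "gdist G u v = gdist G v u"
proof -
  have le: "gdist G y x \<le> gdist G x y" if "x \<in> verts G" "y \<in> verts G" for x y
  proof -
    have "gdist G b x \<le> gdist G a x + 1" if "a \<rightarrow>\<^bsub>G\<^esub> b" for a b
      using gdist_triangle[of b x a] gdist_adj[OF adj_sym[OF that]] \<open>x \<in> verts G\<close>
        adj_in_verts[OF that] by simp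
    then show ?thesis
      using lipschitz_le_gdist[OF that, of "\<lambda>z. int (gdist G z x)"] that by force
  qed
  from le[OF assms] le[OF assms(2,1)] show ?thesis by simp
qed

lemma transmission_sum:
  assumes "x \<in> verts G"
  shows "transmission G x = (\<Sum>u \<in> verts G. gdist G x u)"
  using assms by (simp add: transmission_def sum.remove)

text \<open>
  Each of the other vertices contributes at most \<open>gdist G x y\<close> more to the transmission of \<open>x\<close> than to
  that of \<open>y\<close>, while \<open>x\<close> and \<open>y\<close> themselves contribute \<open>gdist G x y\<close> to both sums.
\<close>

lemma transmission_le:
  assumes "x \<in> verts G" "y \<in> verts G"
  shows "transmission G x + 2 * gdist G x y \<le> transmission G y + card (verts G) * gdist G x y"
proof (cases "x = y")
  case False
  let ?R = "verts G - {x} - {y}" and ?d = "gdist G x y"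
  have split: "sum f (verts G) = f x + f y + sum f ?R" for f :: "'a \<Rightarrow> nat"
    using False assms by (simp add: sum.remove[of _ x] sum.remove[of _ y])
  have "(\<Sum>u\<in>?R. gdist G x u) \<le> (\<Sum>u\<in>?R. gdist G y u + ?d)"
    using assms by (intro sum_mono) (metis Diff_iff add.commute gdist_triangle)
  moreover have "card (verts G) = card ?R + 2"
    using False assms split[of "\<lambda>_. 1"] by simp
  ultimately show ?thesis
    using assms gdist_sym[OF assms] by (simp add: transmission_sum split sum.distrib algebra_simps)
qed (use assms in auto)

lemma gdist_map_le:
  assumes "connected_graph H" "u \<in> verts G" "v \<in> verts G" "f u \<in> verts H"
    and "\<And>x y. x \<rightarrow>\<^bsub>G\<^esub> y \<Longrightarrow> f x \<rightarrow>\<^bsub>H\<^esub> f y"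
  shows "gdist H (f u) (f v) \<le> gdist G u v"
proof -
  interpret H: connected_graph H by fact
  have "int (gdist H (f u) (f v)) \<le> int (gdist H (f u) (f u)) + int (gdist G u v)"
    using H.gdist_lipschitz[OF assms(4) assms(5)]
    by (intro lipschitz_le_gdist assms(2,3)) fastforce
  then show ?thesis using assms(4) by simp
qed

end

section \<open>Parity of transmissions in trees\<close>

context connected_graph
begin

text \<open>
  A repeated vertex splits the walk into two shorter closed walks, one of which has odd length.
\<close>

lemma odd_closed_awalk_imp_odd_cycle:
  assumes "awalk u p u" "odd (length p)"
  shows "\<exists>c. cycle c \<and> odd (length c)"
  using assms
proof (induction "length p" arbitrary: u p rule: less_induct)
  case less
  show ?case
  proof (cases "distinct (tl (awalk_verts u p))")
    case True
    then show ?thesis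
      using less.prems unfolding cycle_def by (metis list.size(3) odd_pos less_irrefl)
  next
    case False
    then obtain e es where p: "p = e # es"
      by (cases p) auto
    with False less.prems have es: "awalk (head G e) es u" "\<not> distinct (awalk_verts (head G e) es)"
      and e: "e \<in> arcs G" "tail G e = u"
      by (auto simp: awalk_Cons_iff)
    obtain q r s x where qrs: "es = q @ r @ s" "0 < length r"
      "awalk (head G e) q x" "awalk x r x" "awalk x s u"
      using awalk_not_distinct_decomp[OF es] by blast
    show ?thesis
    proof (cases "odd (length r)")
      case True
      with less.hyps[OF _ qrs(4)] qrs(1) p show ?thesis by simp
    next
      case even: False
      have "awalk u (e # q @ s) u"
        using e qrs by (auto simp: awalk_Cons_iff)
      moreover have "odd (length (e # q @ s))" "length (e # q @ s) < length p"
        using even less.prems(2) qrs(1,2) p by auto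
      ultimately show ?thesis using less.hyps by blast
    qed
  qed
qed

end

text \<open>
  Only cycles of length at least 3 are forbidden: walking along an edge and back is a
  cycle of length 2 in the sense of \<^const>\<open>pre_digraph.cycle\<close>.
\<close>

locale tree_graph = connected_graph +
  assumes no_cycle: "cycle p \<Longrightarrow> length p < 3"

lemma tree_graph_iff: "tree_graph G \<longleftrightarrow> graph_tree G"
  unfolding tree_graph_def tree_graph_axioms_def connected_graph_def connected_graph_axioms_def
    graph_tree_def by (auto simp: not_le)

context tree_graph
begin

lemma closed_awalk_even:
  assumes "awalk u p u"
  shows "even (length p)"
proof (rule ccontr)
  assume "odd (length p)"
  then obtain c where c: "cycle c" "odd (length c)"
    using odd_closed_awalk_imp_odd_cycle assms by blast
  then have "length c = 1"
    using no_cycle[OF c(1)] by presburger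
  then obtain e where "c = [e]"
    by (metis One_nat_def length_0_conv length_Suc_conv)
  then have "e \<in> arcs G" "tail G e = head G e"
    using c(1) by (auto simp: cycle_def awalk_simps)
  then show False
    using no_loops by blast
qed

text \<open>
  Trees are bipartite: if the sum were even, shortest walks from \<open>u\<close> to the ends of the arc would
  close up with the arc to a closed walk of odd length.
\<close>

lemma adj_gdist_parity:
  assumes "u \<in> verts G" "x \<rightarrow>\<^bsub>G\<^esub> y"
  shows "odd (gdist G u x + gdist G u y)"
proof -
  have xy: "x \<in> verts G" "y \<in> verts G"
    using assms(2) by (auto dest: adj_in_verts)
  obtain p where p: "awalk u p x" "length p = gdist G u x"
    using gdist_apath[OF assms(1) xy(1)] by (metis awalkI_apath)
  obtain q where q: "awalk y q u" "length q = gdist G u y"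
    using gdist_apath[OF xy(2) assms(1)] gdist_sym[OF assms(1) xy(2)] by (metis awalkI_apath)
  obtain e where e: "e \<in> arcs G" "tail G e = x" "head G e = y"
    using assms(2) by (auto simp: arcs_ends_conv)
  have "awalk u (p @ e # q) u"
    using p(1) q(1) e by (auto simp: awalk_Cons_iff)
  from closed_awalk_even[OF this] show ?thesis
    using p(2) q(2) by simp
qed

lemma adj_transmission_parity:
  assumes "x \<rightarrow>\<^bsub>G\<^esub> y"
  shows "even (transmission G x + transmission G y + card (verts G))"
proof -
  have xy: "x \<in> verts G" "y \<in> verts G"
    using assms by (auto dest: adj_in_verts)
  have "transmission G x + transmission G y + card (verts G)
      = (\<Sum>u\<in>verts G. gdist G u x + gdist G u y + 1)"
    using xy by (simp add: transmission_sum sum.distrib gdist_sym[of x] gdist_sym[of y]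
      sum_Suc cong: sum.cong)
  also have "even \<dots>"
    using adj_gdist_parity[OF _ assms] by (intro dvd_sum) simp
  finally show ?thesis .
qed

text \<open>
  Along an arc every distance changes parity, so the transmission changes by the parity of the number
  of vertices. In particular, vertices at the same distance from \<open>r\<close> have transmissions of equal
  parity.
\<close>

lemma transmission_parity:
  assumes "r \<in> verts G" "x \<in> verts G"
  shows "even (transmission G r + transmission G x + card (verts G) * gdist G r x)"
  using assms
proof (induction rule: gdist_induct)
  case root
  then show ?case using assms(1) by simp
next
  case (step x y)
  from step(3) adj_transmission_parity[OF step(1)] show ?case
    by (auto simp: step(2))
qed

end

section \<open>Pendant paths\<close>

lemma nth_in_vwalk_arcs: "Suc i < length p \<Longrightarrow> (p ! i, p ! Suc i) \<in> set (vwalk_arcs p)"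
proof (induction p arbitrary: i rule: vwalk_arcs.induct)
  case (3 x y xs)
  then show ?case by (cases i) auto
qed auto

text \<open>
  Positions are counted from the root, so \<open>P ! k\<close> is the pendant end.
\<close>

locale pendant_path = connected_graph +
  fixes P :: "'a list" and k :: nat
  assumes proper: "proper_pendant_path G P"
    and length_P: "length P = Suc k"
    and k_pos: "0 < k"
begin

abbreviation root :: 'a where "root \<equiv> P ! 0"

definition outer :: "'a set" where "outer = verts G - (set P - {root})"

lemma P_in_verts: "i \<le> k \<Longrightarrow> P ! i \<in> verts G"
  using proper length_P by (auto simp: proper_pendant_path_def vpath_def vwalk_def)

lemma P_nth_eq_iff: "i \<le> k \<Longrightarrow> j \<le> k \<Longrightarrow> P ! i = P ! j \<longleftrightarrow> i = j"
  using proper length_P by (simp add: proper_pendant_path_def vpath_def nth_eq_iff_index_eq)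

lemma P_adj: "i < k \<Longrightarrow> P ! i \<rightarrow>\<^bsub>G\<^esub> P ! Suc i"
  using nth_in_vwalk_arcs[of i P] proper length_P
  by (auto simp: proper_pendant_path_def vpath_def vwalk_def)

lemma P_in_outer_iff: "i \<le> k \<Longrightarrow> P ! i \<in> outer \<longleftrightarrow> i = 0"
  using P_nth_eq_iff[of i 0] P_in_verts[of i] length_P by (auto simp: outer_def)

lemma verts_cases:
  assumes "x \<in> verts G"
  obtains "x \<in> outer" | i where "0 < i" "i \<le> k" "x = P ! i"
proof (cases "x \<in> outer")
  case False
  then obtain i where "i < length P" "x = P ! i" "x \<noteq> root"
    using assms by (auto simp: outer_def in_set_conv_nth)
  then show ?thesis
    using that(2)[of i] length_P by (cases i) auto
qed (rule that(1))

lemma outer_subset: "outer \<subseteq> verts G"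
  by (auto simp: outer_def)

text \<open>
  The degree bound leaves no room for a neighbour besides those on the path.
\<close>

lemma P_neighbour:
  assumes i: "0 < i" "i \<le> k" and adj: "P ! i \<rightarrow>\<^bsub>G\<^esub> y"
  shows "y = P ! (i - 1) \<or> i < k \<and> y = P ! Suc i"
proof -
  let ?N = "head G ` out_arcs G (P ! i)"
  have N: "z \<in> ?N \<longleftrightarrow> P ! i \<rightarrow>\<^bsub>G\<^esub> z" for z
    by (force simp: arcs_ends_conv)
  have fin: "finite ?N" and card_N: "card ?N \<le> out_degree G (P ! i)"
    using finite_out_arcs[of "P ! i"] by (auto simp: out_degree_def intro: card_image_le)
  have prev: "P ! (i - 1) \<in> ?N"
    using adj_sym[OF P_adj[of "i - 1"]] i by (simp add: N)
  have y: "y \<in> ?N"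
    using adj by (simp add: N)
  show ?thesis
  proof (cases "i = k")
    case True
    then have "P ! i = last P"
      using length_P by (simp add: last_conv_nth flip: length_0_conv)
    then have "card ?N \<le> Suc 0"
      using proper card_N by (simp add: proper_pendant_path_def)
    with fin prev y show ?thesis
      by (metis card_le_Suc0_iff_eq)
  next
    case False
    then have "i < k" using i by simp
    have "butlast (tl P) ! (i - 1) = P ! i" "i - 1 < length (butlast (tl P))"
      using i \<open>i < k\<close> length_P by (simp_all add: nth_butlast nth_tl)
    then have "P ! i \<in> set (butlast (tl P))"
      by (metis nth_mem)
    then have "card ?N \<le> 2"
      using proper card_N by (simp add: proper_pendant_path_def)
    moreover have "{P ! (i - 1), P ! Suc i} \<subseteq> ?N"
      using prev P_adj[OF \<open>i < k\<close>] N by blast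
    moreover have "card {P ! (i - 1), P ! Suc i} = 2"
      using P_nth_eq_iff[of "i - 1" "Suc i"] i \<open>i < k\<close> by simp
    ultimately have "{P ! (i - 1), P ! Suc i} = ?N"
      using fin by (metis card_seteq)
    then show ?thesis
      using y \<open>i < k\<close> by blast
  qed
qed

lemma adj_cases:
  assumes "x \<rightarrow>\<^bsub>G\<^esub> y"
  obtains "x \<in> outer" "y \<in> outer"
  | i where "i < k" "x = P ! i" "y = P ! Suc i"
  | i where "i < k" "y = P ! i" "x = P ! Suc i"
proof -
  have *: "\<exists>i<k. a = P ! i \<and> b = P ! Suc i \<or> b = P ! i \<and> a = P ! Suc i"
    if ab: "a \<rightarrow>\<^bsub>G\<^esub> b" "a \<notin> outer" for a b
  proof -
    from adj_in_verts(1)[OF ab(1)] ab(2) obtain i where i: "0 < i" "i \<le> k" "a = P ! i"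
      by (auto elim: verts_cases)
    then show ?thesis
      using P_neighbour[of i b] ab(1) by (metis One_nat_def Suc_le_eq Suc_pred)
  qed
  show ?thesis
    using *[OF assms] *[OF adj_sym[OF assms]] that by blast
qed

text \<open>
  The coordinate along the path, continued below 0 into the outer part by the distance from the root.
  Since the outer part meets the path only in the root, it changes by at most 1 along arcs, so its
  differences bound distances from below. They are the distances whenever one of the two vertices lies
  on the path.
\<close>

definition position :: "'a \<Rightarrow> int" where
  "position x = (if x \<in> outer then - int (gdist G root x) else int (inv_into {..k} ((!) P) x))"

lemma root_in_outer: "root \<in> outer"
  by (simp add: P_in_outer_iff)

lemma root_in_verts: "root \<in> verts G"
  by (simp add: P_in_verts)

lemma position_P: "i \<le> k \<Longrightarrow> position (P ! i) = int i"
proof -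
  assume i: "i \<le> k"
  have "inj_on ((!) P) {..k}"
    by (auto simp: inj_on_def P_nth_eq_iff)
  from inv_into_f_f[OF this, of i] i show ?thesis
    using root_in_verts by (auto simp: position_def P_in_outer_iff)
qed

lemma position_lipschitz:
  assumes "x \<rightarrow>\<^bsub>G\<^esub> y"
  shows "\<bar>position y - position x\<bar> \<le> 1"
  using assms
proof (cases rule: adj_cases)
  case 1
  then show ?thesis
    using gdist_lipschitz[OF root_in_verts assms] gdist_lipschitz[OF root_in_verts adj_sym[OF assms]]
    by (simp add: position_def)
qed (simp_all add: position_P)

lemma position_diff_le_gdist:
  assumes "x \<in> verts G" "y \<in> verts G"
  shows "\<bar>position y - position x\<bar> \<le> int (gdist G x y)"
proof -
  have "position y \<le> position x + int (gdist G x y)"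
    using assms position_lipschitz by (intro lipschitz_le_gdist) (force simp: abs_le_iff)+
  moreover have "- position y \<le> - position x + int (gdist G x y)"
    using assms position_lipschitz by (intro lipschitz_le_gdist) (force simp: abs_le_iff)+
  ultimately show ?thesis by simp
qed

lemma gdist_P_le: "i + j \<le> k \<Longrightarrow> gdist G (P ! i) (P ! (i + j)) \<le> j"
proof (induction j)
  case 0
  then show ?case by (simp add: P_in_verts)
next
  case (Suc j)
  then show ?case
    using gdist_lipschitz[OF P_in_verts P_adj, of i "i + j"] by simp
qed

lemma gdist_P:
  assumes "i \<le> j" "j \<le> k"
  shows "gdist G (P ! i) (P ! j) = j - i"
  using assms gdist_P_le[of i "j - i"] position_diff_le_gdist[of "P ! i" "P ! j"]
  by (simp add: P_in_verts position_P)

lemma gdist_outer_P: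
  assumes "x \<in> outer" "i \<le> k"
  shows "gdist G x (P ! i) = gdist G root x + i"
proof -
  have x: "x \<in> verts G"
    using assms outer_subset by blast
  show ?thesis
    using assms x gdist_triangle[of x "P ! i" root] gdist_P[of 0 i] root_in_verts
      position_diff_le_gdist[of x "P ! i"] gdist_sym[of x root]
    by (simp add: P_in_verts position_P) (simp add: position_def)
qed

text \<open>
  A step towards the pendant end brings the \<open>k - i\<close> vertices ahead closer by 1 and moves all others
  away by 1.
\<close>

lemma transmission_P_Suc:
  assumes "i < k"
  shows "transmission G (P ! Suc i) + 2 * (k - i) = transmission G (P ! i) + card (verts G)"
proof -
  let ?B = "(!) P ` {Suc i..k}"
  have B: "?B \<subseteq> verts G"
    by (auto simp: P_in_verts)
  have card_B: "card ?B = k - i"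
    by (subst card_image) (auto simp: inj_on_def P_nth_eq_iff)
  have "gdist G (P ! Suc i) x + (if x \<in> ?B then 2 else 0) = gdist G (P ! i) x + 1"
    if x: "x \<in> verts G" for x
    using x
  proof (cases rule: verts_cases)
    case 1
    then have "(if x \<in> ?B then 2 else 0 :: nat) = 0"
      by (auto simp: P_in_outer_iff)
    moreover have to_x: "gdist G (P ! j) x = gdist G root x + j" if "j \<le> k" for j
      using gdist_outer_P[OF 1 that] gdist_sym[OF x P_in_verts[OF that]] by metis
    ultimately show ?thesis
      using to_x[of i] to_x[of "Suc i"] assms by linarith
  next
    case (2 m)
    then have "x \<in> ?B \<longleftrightarrow> i < m"
      using assms by (auto simp: P_nth_eq_iff)
    moreover have "gdist G (P ! j) x = (if j \<le> m then m - j else j - m)" if "j \<le> k" for j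
      using gdist_P[of m j] gdist_P[of j m] gdist_sym[OF P_in_verts[OF that] x] 2 that by simp
    ultimately show ?thesis
      using 2 assms by (cases "i < m") auto
  qed
  then have "(\<Sum>x\<in>verts G. gdist G (P ! Suc i) x + (if x \<in> ?B then 2 else 0))
      = (\<Sum>x\<in>verts G. gdist G (P ! i) x + 1)"
    by (rule sum.cong[OF refl])
  moreover have "(\<Sum>x\<in>verts G. if x \<in> ?B then 2 else 0) = 2 * (k - i)"
    using B by (simp add: sum.If_cases Int_absorb1 card_B)
  ultimately show ?thesis
    using assms by (simp add: transmission_sum P_in_verts sum.distrib sum_Suc)
qed

lemma transmission_P:
  "t \<le> k \<Longrightarrow> transmission G (P ! (k - t)) + card (verts G) * t
    = transmission G (P ! k) + t * (t + 1)"
proof (induction t)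
  case (Suc t)
  then have idx: "Suc (k - Suc t) = k - t" "k - (k - Suc t) = Suc t" by simp_all
  have "x + n * Suc t = y + Suc t * (Suc t + 1)"
    if "z + 2 * Suc t = x + n" "z + n * t = y + t * (t + 1)" for x y z n :: nat
    using that by (simp add: algebra_simps)
  moreover have "transmission G (P ! (k - t)) + 2 * Suc t
      = transmission G (P ! (k - Suc t)) + card (verts G)"
    using transmission_P_Suc[of "k - Suc t"] Suc.prems unfolding idx by simp
  moreover have "transmission G (P ! (k - t)) + card (verts G) * t
      = transmission G (P ! k) + t * (t + 1)"
    using Suc by simp
  ultimately show ?case .
qed simp

text \<open>
  Leaving the outer part is never a shortcut: distances from the root within the outer part, extended
  by the position on the path, still change by at most 1 along arcs.
\<close>

lemma gdist_outer_subgraph: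
  assumes "connected_graph (G \<restriction> outer)" "x \<in> outer"
  shows "gdist (G \<restriction> outer) root x = gdist G root x"
proof (rule antisym)
  let ?H = "G \<restriction> outer"
  interpret H: connected_graph ?H by fact
  have sub: "subgraph ?H G"
    using induced_induce[OF outer_subset] by (simp add: induced_subgraph_def)
  have adj: "a \<rightarrow>\<^bsub>?H\<^esub> b" if "a \<rightarrow>\<^bsub>G\<^esub> b" "a \<in> outer" "b \<in> outer" for a b
    using that by (auto simp: arcs_ends_conv)
  show "gdist G root x \<le> gdist ?H root x"
    using H.gdist_map_le[of G root x id] assms root_in_outer root_in_verts adj_mono[OF _ sub]
      connected_graph_axioms by simp
  define h where "h z = (if z \<in> outer then int (gdist ?H root z) else position z)" for z
  have h_P: "h (P ! i) = int i" if "i \<le> k" for i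
    using that H.gdist_self root_in_outer by (auto simp: h_def P_in_outer_iff position_P)
  have "h x \<le> h root + int (gdist G root x)"
  proof (rule lipschitz_le_gdist)
    show "h b \<le> h a + 1" if "a \<rightarrow>\<^bsub>G\<^esub> b" for a b
      using that
    proof (cases rule: adj_cases)
      case 1
      then show ?thesis
        using H.gdist_lipschitz[of root a b] adj[OF that] root_in_outer by (simp add: h_def)
    qed (simp_all add: h_P)
  qed (use assms outer_subset root_in_verts in auto)
  then show "gdist ?H root x \<le> gdist G root x"
    using h_P[of 0] assms by (simp add: h_def)
qed

end

section \<open>Monotonic transmissions\<close>

text \<open>
  The definition compares consecutive levels only. All levels between those of \<open>u\<close> and \<open>x\<close> are
  inhabited, because a shortest path from \<open>v\<close> to \<open>x\<close> meets each of them, so the comparisons chain.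
\<close>

lemma DBTM_transmission_mono:
  assumes DBTM: "DBTM_subtree H S v"
    and ux: "u \<in> verts H" "x \<in> verts H"
    and lt: "1 \<le> gdist H v u" "gdist H v u < gdist H v x"
  shows "transmission S u \<le> transmission S x"
proof -
  interpret H: tree_graph H
    using DBTM by (simp add: DBTM_subtree_def tree_graph_iff)
  have v: "v \<in> verts H"
    using DBTM by (simp add: DBTM_subtree_def)
  have consecutive: "transmission S a \<le> transmission S b"
    if ab: "a \<in> verts H" "b \<in> verts H" "1 \<le> gdist H v a" "gdist H v b = Suc (gdist H v a)" for a b
  proof -
    let ?j = "gdist H v a"
    have fin: "finite (dist_level H v j)" for j
      by (simp add: dist_level_def)
    have "gdist H v b \<le> eccentricity H v"
      unfolding eccentricity_def using ab(2) by (intro Max_ge) (simp_all)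
    then have "Max (transmission S ` dist_level H v ?j) \<le> Min (transmission S ` dist_level H v (?j + 1))"
      using DBTM ab by (simp add: DBTM_subtree_def)
    moreover have "transmission S a \<le> Max (transmission S ` dist_level H v ?j)"
      using ab fin by (intro Max_ge) (auto simp: dist_level_def)
    moreover have "Min (transmission S ` dist_level H v (?j + 1)) \<le> transmission S b"
      using ab fin by (intro Min_le) (auto simp: dist_level_def)
    ultimately show ?thesis by simp
  qed
  have "gdist H v u < gdist H v x \<longrightarrow> transmission S u \<le> transmission S x"
    using v ux(2)
  proof (induction rule: H.gdist_induct)
    case root
    then show ?case using v by simp
  next
    case (step y z)
    have yz: "y \<in> verts H" "z \<in> verts H"
      using H.adj_in_verts[OF step(1)] by auto
    show ?case
    proof
      assume "gdist H v u < gdist H v z"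
      then consider "gdist H v u < gdist H v y" | "gdist H v y = gdist H v u"
        using step(2) by linarith
      then show "transmission S u \<le> transmission S z"
      proof cases
        case 1
        then show ?thesis
          using step(2,3) lt(1) yz consecutive[of y z] by simp
      next
        case 2
        then show ?thesis
          using step(2) lt(1) ux(1) yz consecutive[of u z] by simp
      qed
    qed
  qed
  with lt(2) show ?thesis by simp
qed

section \<open>Joining two copies\<close>

locale joined_copies = G: connected_graph "with_proj G"
  for G :: "'a pair_pre_digraph" +
  fixes G' :: "'a pair_pre_digraph" and \<phi> :: "'a \<Rightarrow> 'a" and v w :: 'a
  assumes copy: "is_copy \<phi> G G'"
    and disjoint: "pverts G \<inter> pverts G' = {}"
    and w_new: "w \<notin> pverts G \<union> pverts G'"
    and v: "v \<in> pverts G"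
begin

definition T :: "('a, 'a \<times> 'a) pre_digraph" where
  "T = with_proj (join_with_leaf G v G' (\<phi> v) w)"

lemma G_adj_in_verts: "(x, y) \<in> parcs G \<Longrightarrow> x \<in> pverts G \<and> y \<in> pverts G"
  using G.adj_in_verts[of x y] by simp

lemma G'_def: "pverts G' = \<phi> ` pverts G" "parcs G' = map_prod \<phi> \<phi> ` parcs G"
  using copy by (auto simp: is_copy_def bij_betw_def)

lemma inj: "inj_on \<phi> (pverts G)"
  using copy by (auto simp: is_copy_def bij_betw_def)

lemma copy_notin: "x \<in> pverts G \<Longrightarrow> \<phi> x \<notin> pverts G" "x \<in> pverts G \<Longrightarrow> \<phi> x \<noteq> w"
  using disjoint w_new by (auto simp: G'_def)

lemma verts_T: "verts T = insert w (pverts G \<union> \<phi> ` pverts G)"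
  by (auto simp: T_def join_with_leaf_def G'_def)

lemma arcs_ends_T: "arcs_ends T = parcs G \<union> map_prod \<phi> \<phi> ` parcs G \<union>
    {(v, \<phi> v), (\<phi> v, v), (v, w), (w, v)}"
  by (auto simp: T_def join_with_leaf_def G'_def)

lemma graph_T: "graph T"
  unfolding T_def
proof (rule pair_graph.pair_graphD_graph, unfold_locales)
  let ?T = "join_with_leaf G v G' (\<phi> v) w"
  have parcs: "parcs ?T = arcs_ends T" and pverts: "pverts ?T = verts T"
    by (simp_all add: T_def)
  fix e assume "e \<in> parcs ?T"
  then consider "e \<in> parcs G" | e' where "e' \<in> parcs G" "e = map_prod \<phi> \<phi> e'"
    | "e \<in> {(v, \<phi> v), (\<phi> v, v), (v, w), (w, v)}"
    by (auto simp: parcs arcs_ends_T)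
  then have "fst e \<in> verts T \<and> snd e \<in> verts T \<and> fst e \<noteq> snd e"
  proof cases
    case 1
    then show ?thesis
      using G_adj_in_verts[of "fst e" "snd e"] G.no_loops[of e] by (simp add: verts_T)
  next
    case 2
    then show ?thesis
      using G_adj_in_verts[of "fst e'" "snd e'"] G.no_loops[of e'] inj_onD[OF inj, of "fst e'" "snd e'"]
      by (auto simp: verts_T)
  next
    case 3
    then show ?thesis
      using v w_new copy_notin[OF v] by (auto simp: verts_T)
  qed
  then show "fst e \<in> pverts ?T" "snd e \<in> pverts ?T" "fst e \<noteq> snd e"
    by (simp_all add: pverts)
next
  let ?T = "join_with_leaf G v G' (\<phi> v) w"
  show "finite (pverts ?T)" "finite (parcs ?T)"
    using G.finite_verts G.finite_arcs by (auto simp: join_with_leaf_def G'_def)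
  have "sym (arcs_ends T)"
    using G.adj_sym by (auto simp: arcs_ends_T sym_def)
  then show "symmetric (with_proj ?T)"
    by (simp add: symmetric_def T_def)
qed

lemma connected_T: "Digraph_Component.connected T"
proof -
  interpret T: graph T by (rule graph_T)
  have left: "v \<rightarrow>\<^sup>*\<^bsub>T\<^esub> x" if "v \<in> verts (with_proj G)" "x \<in> verts (with_proj G)" for x
    using that
  proof (induction rule: G.gdist_induct)
    case root
    then show ?case using v by (simp add: verts_T)
  next
    case (step x y)
    then have "x \<rightarrow>\<^bsub>T\<^esub> y"
      by (simp add: arcs_ends_T)
    with step(3) show ?case by (rule T.reachable_adj_trans)
  qed
  have right: "v \<rightarrow>\<^sup>*\<^bsub>T\<^esub> \<phi> x" if "v \<in> verts (with_proj G)" "x \<in> verts (with_proj G)" for x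
    using that
  proof (induction rule: G.gdist_induct)
    case root
    show ?case by (rule T.reachable_adjI) (simp add: arcs_ends_T)
  next
    case (step x y)
    then have "\<phi> x \<rightarrow>\<^bsub>T\<^esub> \<phi> y"
      by (force simp: arcs_ends_T)
    with step(3) show ?case by (rule T.reachable_adj_trans)
  qed
  have reach: "v \<rightarrow>\<^sup>*\<^bsub>T\<^esub> x" if "x \<in> verts T" for x
    using that left right v T.reachable_adjI[of v w] by (auto simp: verts_T arcs_ends_T)
  have "x \<rightarrow>\<^sup>*\<^bsub>T\<^esub> y" if "x \<in> verts T" "y \<in> verts T" for x y
    using T.reachable_trans[OF symmetric_reachable[OF T.sym_arcs reach] reach] that by blast
  then show ?thesis
    using verts_T by (intro T.connectedI) (auto simp: T.reachable_mk_symmetric_eq[OF T.sym_arcs])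
qed

sublocale T: connected_graph T
  unfolding connected_graph_def connected_graph_axioms_def using graph_T connected_T by simp

abbreviation "d \<equiv> gdist (with_proj G)"

text \<open>
  Meaningful only on the vertices of the copy.
\<close>

definition orig :: "'a \<Rightarrow> 'a" where "orig = inv_into (pverts G) \<phi>"

lemma orig_copy: "x \<in> pverts G \<Longrightarrow> orig (\<phi> x) = x"
  unfolding orig_def using inj by (rule inv_into_f_f)

lemma T_adj_cases:
  assumes "x \<rightarrow>\<^bsub>T\<^esub> y"
  obtains "x \<in> pverts G" "y \<in> pverts G" "(x, y) \<in> parcs G"
  | a b where "a \<in> pverts G" "b \<in> pverts G" "(a, b) \<in> parcs G" "x = \<phi> a" "y = \<phi> b"
  | "x = v" "y = \<phi> v" | "x = \<phi> v" "y = v" | "x = v" "y = w" | "x = w" "y = v"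
  using assms G_adj_in_verts unfolding arcs_ends_T by blast

text \<open>
  A function given separately on the two copies and the leaf bounds distances from below as soon as it
  changes by at most 1 within each copy and across the two new edges.
\<close>

lemma glued_lipschitz_le_gdist:
  fixes f g :: "'a \<Rightarrow> nat" and c :: nat
  defines "h \<equiv> \<lambda>x. if x \<in> pverts G then f x else if x = w then c else g (orig x)"
  assumes f: "\<And>a b. (a, b) \<in> parcs G \<Longrightarrow> f b \<le> f a + 1"
    and g: "\<And>a b. (a, b) \<in> parcs G \<Longrightarrow> g b \<le> g a + 1"
    and bridges: "f v \<le> g v + 1" "g v \<le> f v + 1" "f v \<le> c + 1" "c \<le> f v + 1"
    and xy: "x \<in> verts T" "y \<in> verts T"
  shows "h y \<le> h x + gdist T x y"
proof -
  have h: "h x = f x" "h (\<phi> x) = g x" if "x \<in> pverts G" for x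
    using that copy_notin orig_copy by (auto simp: h_def)
  have h_w: "h w = c"
    using w_new by (simp add: h_def)
  have "h b \<le> h a + 1" if "a \<rightarrow>\<^bsub>T\<^esub> b" for a b
    using that
  proof (cases rule: T_adj_cases)
    case 1
    then show ?thesis using f[of a b] by (simp add: h)
  next
    case (2 a' b')
    then show ?thesis using g[of a' b'] by (simp add: h)
  qed (use bridges v in \<open>simp_all add: h h_w\<close>)
  then have "int (h y) \<le> int (h x) + int (gdist T x y)"
    by (intro T.lipschitz_le_gdist xy) fastforce
  then show ?thesis by simp
qed

text \<open>
  The new edges are bridges, so each distance is the sum of its parts. The upper bounds come from the
  embeddings of the two copies and the triangle inequality at \<open>v\<close> and \<open>\<phi> v\<close>. The formulas themselves,
  as functions of the far end, give the lower bounds.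
\<close>

lemma gdist_T:
  assumes "x \<in> pverts G" "y \<in> pverts G"
  shows "gdist T x y = d x y"
    and "gdist T x (\<phi> y) = d x v + 1 + d v y"
    and "gdist T x w = d x v + 1"
    and "gdist T (\<phi> x) (\<phi> y) = d x y"
    and "gdist T (\<phi> x) w = d x v + 2"
proof -
  have left: "gdist T a b \<le> d a b" and right: "gdist T (\<phi> a) (\<phi> b) \<le> d a b"
    if "a \<in> pverts G" "b \<in> pverts G" for a b
    using G.gdist_map_le[OF T.connected_graph_axioms, of a b id]
      G.gdist_map_le[OF T.connected_graph_axioms, of a b \<phi>] that
    by (auto simp: verts_T arcs_ends_T)
  have bridge: "gdist T v (\<phi> v) \<le> 1" "gdist T (\<phi> v) v \<le> 1" "gdist T v w \<le> 1"
    by (rule T.gdist_adj; simp add: arcs_ends_T)+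
  have in_T: "x \<in> verts T" "\<phi> x \<in> verts T" "y \<in> verts T" "\<phi> y \<in> verts T"
    "v \<in> verts T" "\<phi> v \<in> verts T" "w \<in> verts T"
    using assms v by (auto simp: verts_T)
  have upper: "gdist T x (\<phi> y) \<le> d x v + 1 + d v y" "gdist T x w \<le> d x v + 1"
    "gdist T (\<phi> x) w \<le> d x v + 2"
    using T.gdist_triangle[of x "\<phi> y" v] T.gdist_triangle[of v "\<phi> y" "\<phi> v"]
      T.gdist_triangle[of x w v] T.gdist_triangle[of "\<phi> x" w "\<phi> v"]
      T.gdist_triangle[of "\<phi> v" w v] left[of x v] right[of v y] right[of x v] bridge in_T assms v
    by simp_all
  note lip = G.gdist_lipschitz[unfolded with_proj_simps]
  let ?h = "\<lambda>z. if z \<in> pverts G then d x z else if z = w then d x v + 1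
    else d x v + 1 + d v (orig z)"
  have 1: "?h z \<le> ?h x + gdist T x z" if "z \<in> verts T" for z
    by (rule glued_lipschitz_le_gdist[where g = "\<lambda>a. d x v + 1 + d v a"])
      (use that assms in_T v lip in \<open>auto\<close>)
  let ?h' = "\<lambda>z. if z \<in> pverts G then d x v + 1 + d v z else if z = w then d x v + 2
    else d x (orig z)"
  have 2: "?h' z \<le> ?h' (\<phi> x) + gdist T (\<phi> x) z" if "z \<in> verts T" for z
    by (rule glued_lipschitz_le_gdist[where f = "\<lambda>a. d x v + 1 + d v a"])
      (use that assms in_T v lip in \<open>auto\<close>)
  note out = assms[THEN copy_notin(1)] assms[THEN copy_notin(2)] orig_copy[OF assms(1)] orig_copy[OF assms(2)]
  have "d x y \<le> gdist T x y" "d x v + 1 + d v y \<le> gdist T x (\<phi> y)" "d x v + 1 \<le> gdist T x w"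
    using 1[OF in_T(3)] 1[OF in_T(4)] 1[OF in_T(7)] assms out w_new by simp_all
  with upper left[OF assms] show "gdist T x y = d x y"
    "gdist T x (\<phi> y) = d x v + 1 + d v y" "gdist T x w = d x v + 1"
    by linarith+
  have "d x y \<le> gdist T (\<phi> x) (\<phi> y)" "d x v + 2 \<le> gdist T (\<phi> x) w"
    using 2[OF in_T(4)] 2[OF in_T(7)] assms out w_new by simp_all
  with upper right[OF assms] show "gdist T (\<phi> x) (\<phi> y) = d x y" "gdist T (\<phi> x) w = d x v + 2"
    by linarith+
qed

lemma sum_verts_T:
  "sum f (verts T) = f w + (\<Sum>x\<in>pverts G. f x) + (\<Sum>x\<in>pverts G. f (\<phi> x))"
proof -
  have "finite (pverts G)"
    using G.finite_verts by simp
  moreover have "pverts G \<inter> \<phi> ` pverts G = {}" "w \<notin> pverts G \<union> \<phi> ` pverts G"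
    using disjoint w_new by (simp_all add: G'_def)
  ultimately show ?thesis
    by (simp add: verts_T sum.union_disjoint sum.reindex[OF inj] add.assoc)
qed

abbreviation "Tr \<equiv> transmission (with_proj G)"

lemma Tr_sum: "x \<in> pverts G \<Longrightarrow> (\<Sum>y\<in>pverts G. d x y) = Tr x"
  using G.transmission_sum[of x] by simp

text \<open>
  A vertex and its image see the same distances with one exception: the leaf \<open>w\<close> is nearer by 1 to
  the vertex in whose copy it is attached.
\<close>

lemma transmission_T:
  assumes x: "x \<in> pverts G"
  shows "transmission T x = Tr x + (card (pverts G) + 1) * (d x v + 1) + Tr v"
    and "transmission T (\<phi> x) = transmission T x + 1"
proof -
  have in_T: "x \<in> verts T" "\<phi> x \<in> verts T"
    using x by (auto simp: verts_T)
  show 1: "transmission T x = Tr x + (card (pverts G) + 1) * (d x v + 1) + Tr v"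
    using x v in_T by (simp add: T.transmission_sum sum_verts_T gdist_T sum.distrib sum_Suc Tr_sum
      cong: sum.cong)
  have "gdist T (\<phi> x) y = d y v + 1 + d v x" if "y \<in> pverts G" for y
    using gdist_T(2)[OF that x] T.gdist_sym[of y "\<phi> x"] that in_T by (simp add: verts_T)
  then have "transmission T (\<phi> x) = Tr x + (card (pverts G) + 1) * (d x v + 1) + Tr v + 1"
    using x v in_T G.gdist_sym[of _ v]
    by (simp add: T.transmission_sum sum_verts_T gdist_T sum.distrib sum_Suc Tr_sum
      cong: sum.cong)
  with 1 show "transmission T (\<phi> x) = transmission T x + 1"
    by simp
qed

lemma transmission_T_leaf: "transmission T w = 2 * Tr v + 3 * card (pverts G)"
proof -
  have "gdist T w x = d v x + 1 \<and> gdist T w (\<phi> x) = d v x + 2" if x: "x \<in> pverts G" for x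
  proof -
    have "gdist T w x = gdist T x w" "gdist T w (\<phi> x) = gdist T (\<phi> x) w" "d x v = d v x"
      using x v by (auto simp: verts_T intro!: T.gdist_sym G.gdist_sym)
    with gdist_T(3,5)[OF x x] show ?thesis by linarith
  qed
  moreover have "w \<in> verts T"
    by (simp add: verts_T)
  ultimately show ?thesis
    using v by (simp add: T.transmission_sum sum_verts_T sum.distrib sum_Suc Tr_sum cong: sum.cong)
qed

end

section \<open>Separation\<close>

lemma square_less_gap:
  fixes a b :: nat
  assumes "a < b"
  shows "a\<^sup>2 + 2 * a + 1 \<le> b\<^sup>2"
  using power_mono[of "Suc a" b 2] assms by (simp add: power2_eq_square)

text \<open>
  The transmissions of a vertex and of its image differ by exactly 1, so the two copies do not collide
  if distinct vertices of one copy have transmissions that differ by at least 2.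
\<close>

definition separated :: "nat \<Rightarrow> nat \<Rightarrow> bool" where
  "separated a b \<longleftrightarrow> a + 2 \<le> b \<or> b + 2 \<le> a"

lemma separated_sym: "separated a b \<Longrightarrow> separated b a"
  by (auto simp: separated_def)

context pendant_path
begin

text \<open>
  The transmission of \<open>x\<close> in the tree formed by joining two copies at their pendant ends and
  attaching a leaf there, expressed within one copy.
\<close>

definition joined_transmission :: "'a \<Rightarrow> nat" where
  "joined_transmission x = transmission G x + (card (verts G) + 1) * (gdist G x (P ! k) + 1) + transmission G (P ! k)"

abbreviation "D \<equiv> transmission G (P ! k)"
abbreviation "n \<equiv> card (verts G)"

text \<open>
  The linear term that the transmissions lose along the path is cancelled by the distance term of
  \<^const>\<open>joined_transmission\<close>, up to completing the square.
\<close>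

lemma joined_transmission_P:
  assumes "t \<le> k"
  shows "joined_transmission (P ! (k - t)) = 2 * D + n + (t + 1)\<^sup>2"
proof -
  have "y + (m + 1) * (t + 1) + z = 2 * z + m + (t + 1)\<^sup>2"
    if "y + m * t = z + t * (t + 1)" for y z m :: nat
    using that by (simp add: power2_eq_square algebra_simps)
  from this[OF transmission_P[OF assms]] show ?thesis
    using gdist_P[of "k - t" k] assms by (simp add: joined_transmission_def)
qed

lemma joined_transmission_root: "joined_transmission root = 2 * D + n + (k + 1)\<^sup>2"
  using joined_transmission_P[of k] by simp

lemma joined_transmission_outer:
  assumes "x \<in> outer"
  shows "joined_transmission x = transmission G x + (n + 1) * (gdist G root x + k + 1) + D"
  using gdist_outer_P[OF assms, of k] by (simp add: joined_transmission_def)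

lemma joined_transmission_outer_ge:
  assumes "x \<in> outer"
  shows "joined_transmission root + 3 * gdist G root x \<le> joined_transmission x"
proof -
  let ?m = "gdist G root x"
  have "transmission G root + 2 * ?m \<le> transmission G x + n * ?m"
    using assms outer_subset root_in_verts by (intro transmission_le) auto
  then show ?thesis
    using joined_transmission_outer[OF assms] joined_transmission_outer[OF root_in_outer] root_in_verts
    by (simp add: algebra_simps)
qed

text \<open>
  Within the outer part, vertices at equal distance from the root have transmissions that are distinct
  but of the same parity. At different distances, the transmission does not decrease with the distance
  and the distance term grows by at least \<open>n + 1\<close>. The root itself is a case of its own, because the
  monotonicity hypothesis starts at distance 1.
\<close>

lemma joined_transmission_outer_separated:
  assumes tree: "tree_graph G"
    and DBTM: "DBTM_subtree (G \<restriction> outer) G root"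
    and irregular: "partially_transmission_irregular (G \<restriction> outer) G"
    and xy: "x \<in> outer" "y \<in> outer" "x \<noteq> y"
  shows "separated (joined_transmission x) (joined_transmission y)"
proof -
  interpret tree_graph G by fact
  let ?H = "G \<restriction> outer"
  have "tree_graph ?H"
    using DBTM by (simp add: DBTM_subtree_def tree_graph_iff)
  then have "connected_graph ?H"
    by (simp add: tree_graph_def)
  note gdist_H = gdist_outer_subgraph[OF this]
  have fin: "finite outer"
    using finite_subset[OF outer_subset] by simp
  have inj: "inj_on (transmission G) outer"
    using irregular fin by (intro eq_card_imp_inj_on) (simp_all add: partially_transmission_irregular_def)
  have le: "separated (joined_transmission x) (joined_transmission y)"
    if "x \<in> outer" "y \<in> outer" "x \<noteq> y" "gdist G root x \<le> gdist G root y" for x y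
  proof -
    have in_verts: "x \<in> verts G" "y \<in> verts G"
      using that outer_subset by auto
    consider (root) "gdist G root x = 0"
      | (level) "gdist G root y = gdist G root x"
      | (higher) "0 < gdist G root x" "gdist G root x < gdist G root y"
      using \<open>gdist G root x \<le> gdist G root y\<close> by linarith
    then show ?thesis
    proof cases
      case root
      then have "x = P ! 0"
        using gdist_0[OF root_in_verts in_verts(1)] by simp
      moreover from this have "gdist G (P ! 0) y \<noteq> 0"
        using gdist_0[OF root_in_verts in_verts(2)] \<open>x \<noteq> y\<close> by blast
      ultimately show ?thesis
        using joined_transmission_outer_ge[OF \<open>y \<in> outer\<close>] by (simp add: separated_def)
    next
      case level
      have "transmission G x \<noteq> transmission G y"
        using inj that by (auto dest: inj_onD)
      moreover have "even (transmission G x + transmission G y)"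
        using transmission_parity[OF root_in_verts in_verts(1)]
          transmission_parity[OF root_in_verts in_verts(2)] level by auto
      ultimately have "separated (transmission G x) (transmission G y)"
        unfolding separated_def by presburger
      then show ?thesis
        using joined_transmission_outer that(1,2) level by (simp add: separated_def)
    next
      case higher
      have "transmission G x \<le> transmission G y"
        using higher that(1,2) gdist_H by (intro DBTM_transmission_mono[OF DBTM]) auto
      moreover have "(n + 1) * (gdist G root x + k + 1) + (n + 1) \<le> (n + 1) * (gdist G root y + k + 1)"
        using mult_le_mono2[of "gdist G root x + k + 2" "gdist G root y + k + 1" "n + 1"] higher(2)
        by (simp add: algebra_simps)
      moreover have "1 \<le> n"
        using in_verts by (auto simp: Suc_le_eq card_gt_0_iff)
      ultimately show ?thesis
        using joined_transmission_outer that(1,2) by (simp add: separated_def)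
    qed
  qed
  show ?thesis
    using le[OF xy] le[OF xy(2,1)] xy(3) by (cases "gdist G root x \<le> gdist G root y")
      (auto intro: separated_sym)
qed

lemma verts_joined_transmission_cases:
  assumes "x \<in> verts G"
  obtains (outer) "x \<in> outer" "2 * D + n + (k + 1)\<^sup>2 \<le> joined_transmission x"
  | (path) t where "t < k" "x = P ! (k - t)" "joined_transmission x = 2 * D + n + (t + 1)\<^sup>2"
  using assms
proof (cases rule: verts_cases)
  case 1
  then show ?thesis
    using outer joined_transmission_outer_ge[OF 1] joined_transmission_root by simp
next
  case (2 i)
  then show ?thesis
    using path[of "k - i"] joined_transmission_P[of "k - i"] by simp
qed

lemma joined_transmission_separated:
  assumes outer_separated: "\<And>x y. x \<in> outer \<Longrightarrow> y \<in> outer \<Longrightarrow> x \<noteq> y \<Longrightarrow> separated (joined_transmission x) (joined_transmission y)"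
    and xy: "x \<in> verts G" "y \<in> verts G" "x \<noteq> y"
  shows "separated (joined_transmission x) (joined_transmission y)"
proof -
  have path_outer: "separated (2 * D + n + (t + 1)\<^sup>2) b"
    if "t < k" "2 * D + n + (k + 1)\<^sup>2 \<le> b" for t b
    using square_less_gap[of "t + 1" "k + 1"] that by (simp add: separated_def)
  show ?thesis
    using xy(1)
  proof (cases rule: verts_joined_transmission_cases)
    case x: outer
    show ?thesis
      using xy(2)
    proof (cases rule: verts_joined_transmission_cases)
      case outer
      with x outer_separated xy show ?thesis by blast
    next
      case (path t)
      with x path_outer show ?thesis by (metis separated_sym)
    qed
  next
    case x: (path t)
    show ?thesis
      using xy(2)
    proof (cases rule: verts_joined_transmission_cases)
      case outer
      with x path_outer show ?thesis by metis
    next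
      case (path s)
      then have "s \<noteq> t"
        using x xy(3) by blast
      then show ?thesis
        using x(3) path(3) square_less_gap[of "t + 1" "s + 1"] square_less_gap[of "s + 1" "t + 1"]
        by (cases "s < t") (simp_all add: separated_def)
    qed
  qed
qed

text \<open>
  Measured from \<open>2 * D + n\<close>, the leaf has the value \<open>2 * n\<close> and the path takes square values. A
  collision with the path would make \<open>2 * n\<close> a square or a square plus 1, which \<open>j\<close> excludes. As \<open>j\<close> is
  at most \<open>k\<close>, the outer part, whose values are at least \<open>(k + 1)\<^sup>2\<close>, lies beyond \<open>2 * n\<close>.
\<close>

lemma joined_transmission_avoids_leaf:
  assumes j: "1 \<le> j" "j \<le> k" "j\<^sup>2 + 1 < 2 * n" "2 * n < (j + 1)\<^sup>2"
    and x: "x \<in> verts G"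
  shows "joined_transmission x \<noteq> 2 * D + 3 * n" "joined_transmission x + 1 \<noteq> 2 * D + 3 * n"
proof -
  have far: "2 * n < (t + 1)\<^sup>2" if "j \<le> t" for t
    using j(4) power_mono[of "j + 1" "t + 1" 2] that by linarith
  have near: "(t + 1)\<^sup>2 + 1 < 2 * n" if "t < j" for t
    using j(3) power_mono[of "t + 1" j 2] that by linarith
  have "2 * D + 3 * n < joined_transmission x \<or> joined_transmission x + 1 < 2 * D + 3 * n"
    using x
  proof (cases rule: verts_joined_transmission_cases)
    case outer
    then show ?thesis
      using far[OF j(2)] by linarith
  next
    case (path t)
    then show ?thesis
      using far[of t] near[of t] by (cases "j \<le> t") simp_all
  qed
  then show "joined_transmission x \<noteq> 2 * D + 3 * n" "joined_transmission x + 1 \<noteq> 2 * D + 3 * n"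
    by auto
qed

end

lemma (in joined_copies) transmission_irregular_T:
  assumes separated: "\<And>x y. x \<in> pverts G \<Longrightarrow> y \<in> pverts G \<Longrightarrow> x \<noteq> y \<Longrightarrow>
      separated (transmission T x) (transmission T y)"
    and leaf: "\<And>x. x \<in> pverts G \<Longrightarrow> transmission T x \<noteq> transmission T w \<and>
      transmission T x + 1 \<noteq> transmission T w"
  shows "transmission_irregular T"
proof -
  have distinct: "transmission T x \<noteq> transmission T (\<phi> y)" "x \<noteq> y \<Longrightarrow> transmission T x \<noteq> transmission T y"
    if "x \<in> pverts G" "y \<in> pverts G" for x y
    using separated[OF that] transmission_T(2)[OF that(2)]
    by (cases "x = y"; simp add: separated_def; linarith)+
  show ?thesis
    unfolding transmission_irregular_def
  proof (intro ballI impI)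
    fix a b assume ab: "a \<in> verts T" "b \<in> verts T" "a \<noteq> b"
    consider "a = w" | "b = w" | "a \<in> pverts G" "b \<in> pverts G"
      | x where "a \<in> pverts G" "x \<in> pverts G" "b = \<phi> x"
      | x where "b \<in> pverts G" "x \<in> pverts G" "a = \<phi> x"
      | x y where "x \<in> pverts G" "y \<in> pverts G" "a = \<phi> x" "b = \<phi> y"
      using ab(1,2) unfolding verts_T by blast
    then show "transmission T a \<noteq> transmission T b"
    proof cases
      case 1
      then show ?thesis
        using ab(2,3) leaf transmission_T(2) unfolding verts_T by fastforce
    next
      case 2
      then show ?thesis
        using ab(1,3) leaf transmission_T(2) unfolding verts_T by fastforce
    next
      case 3
      with distinct ab(3) show ?thesis by blast
    next
      case 4
      with distinct show ?thesis by blast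
    next
      case 5
      with distinct show ?thesis by metis
    next
      case (6 x y)
      then show ?thesis
        using distinct(2)[of x y] ab(3) transmission_T(2)[of x] transmission_T(2)[of y] by auto
    qed
  qed
qed

theorem theorem3p3:
  fixes T\<^sub>0 T\<^sub>0' :: "'a pair_pre_digraph"
    and T\<^sub>0star :: "('a, 'a \<times> 'a) pre_digraph"
    and P :: "'a list"
    and \<phi> :: "'a \<Rightarrow> 'a"
    and w :: 'a
    and n k :: nat
  assumes "graph_tree (with_proj T\<^sub>0)"
    and "card (pverts T\<^sub>0) = n" and "n \<ge> 7"
    and "proper_pendant_path (with_proj T\<^sub>0) P" and "vwalk_length P = k"
    and "T\<^sub>0star = with_proj T\<^sub>0 \<restriction> (pverts T\<^sub>0 - (set P - {hd P}))"
    and "is_copy \<phi> T\<^sub>0 T\<^sub>0'" and "pverts T\<^sub>0 \<inter> pverts T\<^sub>0' = {}"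
    and "w \<notin> pverts T\<^sub>0 \<union> pverts T\<^sub>0'"
    and "partially_transmission_irregular T\<^sub>0star (with_proj T\<^sub>0)"
    and "DBTM_subtree T\<^sub>0star (with_proj T\<^sub>0) (hd P)"
    and "\<exists>j \<in> {1..k}. j\<^sup>2 + 1 < 2 * n \<and> 2 * n < (j + 1)\<^sup>2"
  shows "transmission_irregular
    (with_proj (join_with_leaf T\<^sub>0 (last P) T\<^sub>0' (\<phi> (last P)) w))"
proof -
  let ?G = "with_proj T\<^sub>0"
  obtain j where j: "1 \<le> j" "j \<le> k" "j\<^sup>2 + 1 < 2 * n" "2 * n < (j + 1)\<^sup>2"
    using assms(12) by auto
  have tree: "tree_graph ?G"
    using assms(1) by (simp add: tree_graph_iff)
  then interpret G: tree_graph ?G .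
  have len: "length P = Suc k" "0 < k"
    using assms(5) j by auto
  have hd_last: "hd P = P ! 0" "last P = P ! k"
    using len(1) by (simp_all add: hd_conv_nth last_conv_nth flip: length_0_conv)
  interpret P: pendant_path ?G P k
    by unfold_locales (use assms(4) len in auto)
  interpret J: joined_copies T\<^sub>0 T\<^sub>0' \<phi> "P ! k" w
    by unfold_locales (use assms(7-9) P.P_in_verts[of k] in auto)
  have star: "T\<^sub>0star = ?G \<restriction> P.outer"
    unfolding assms(6) P.outer_def hd_last with_proj_simps ..
  have "separated (P.joined_transmission x) (P.joined_transmission y)" if "x \<in> P.outer" "y \<in> P.outer" "x \<noteq> y" for x y
    using assms(11,10) that unfolding star hd_last by (rule P.joined_transmission_outer_separated[OF tree])
  then have "separated (P.joined_transmission x) (P.joined_transmission y)"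
    if "x \<in> pverts T\<^sub>0" "y \<in> pverts T\<^sub>0" "x \<noteq> y" for x y
    using that by (rule P.joined_transmission_separated[unfolded with_proj_simps])
  moreover have "P.joined_transmission x = transmission J.T x" if "x \<in> pverts T\<^sub>0" for x
    using J.transmission_T(1)[OF that] by (simp add: P.joined_transmission_def)
  moreover have "P.joined_transmission x \<noteq> transmission J.T w \<and> P.joined_transmission x + 1 \<noteq> transmission J.T w"
    if "x \<in> pverts T\<^sub>0" for x
    using P.joined_transmission_avoids_leaf[of j x] that j assms(2) by (simp add: J.transmission_T_leaf)
  ultimately have "transmission_irregular J.T"
    by (intro J.transmission_irregular_T) simp_all
  then show ?thesis
    unfolding J.T_def hd_last .
qed

end
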